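(* Let $\mathcal F$ be a family of graphs. For all graphs $G$ and $H$, $$\iota(G\boxtimes H,\mathcal F)\ge \max\{\rho_2(G)\,\iota(H,\mathcal F),\ \rho_2(H)\,\iota(G,\mathcal F)\}.$$ Moreover, the bound is sharp for any family $\mathcal F$: for every family $\mathcal F$ of graphs there exist graphs $G$ and $H$ for which equality holds.
   Context: All graphs are finite, simple and undirected. The strong product $G\boxtimes H$ has vertex set $V(G)\times V(H)$, and distinct vertices $(g,h)$, $(g',h')$ are adjacent if and only if ($g=g'$ or $gg'\in E(G)$) and ($h=h'$ or $hh'\in E(H)$). A set $S\subseteq V(G)$ is an $\mathcal F$-isolating set of $G$ if the subgraph induced by $V(G)-N_G[S]$ contains no (not necessarily induced) subgraph isomorphic to a member of $\mathcal F$, where $N_G[S]$ is the closed neighborhood of $S$; $\iota(G,\mathcal F)$ is the minimum cardinality of an $\mathcal F$-isolating set of $G$. A $2$-packing of $G$ is a set of vertices that are pairwise at distance at least three; $\rho_2(G)$ is the maximum cardinality of a $2$-packing of $G$. *)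

theory Defs
  imports
    "HOL-Library.Extended_Nat"
    "Graph_Theory.Pair_Digraph"
    "Graph_Theory.Digraph_Component"
    "Graph_Theory.Digraph_Isomorphism"
    "Graph_Theory.Shortest_Path"
begin

text \<open>
  A finite simple undirected graph is a \<^locale>\<open>pair_graph\<close>: a finite, loop-free, symmetric digraph
  without parallel arcs, so that an edge \<open>uv\<close> is the pair of arcs \<open>(u,v)\<close>, \<open>(v,u)\<close>.
\<close>

definition strong_product ::
  "'a pair_pre_digraph \<Rightarrow> 'b pair_pre_digraph \<Rightarrow> ('a \<times> 'b) pair_pre_digraph" (infixl "\<boxtimes>" 70)
  where
  "G \<boxtimes> H = \<lparr> pverts = pverts G \<times> pverts H,
     parcs = {((g, h), (g', h')).
       g \<in> pverts G \<and> h \<in> pverts H \<and> g' \<in> pverts G \<and> h' \<in> pverts H \<and>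
       (g, h) \<noteq> (g', h') \<and>
       (g = g' \<or> (g, g') \<in> parcs G) \<and> (h = h' \<or> (h, h') \<in> parcs H)} \<rparr>"

definition closed_neighborhood :: "'a pair_pre_digraph \<Rightarrow> 'a set \<Rightarrow> 'a set" where
  "closed_neighborhood G S = S \<union> {v. \<exists>u\<in>S. (u, v) \<in> parcs G}"

text \<open>Subgraphs need not be induced.\<close>

definition contains_copy :: "('a, 'b) pre_digraph \<Rightarrow> 'c pair_pre_digraph \<Rightarrow> bool" where
  "contains_copy G F \<longleftrightarrow> (\<exists>K. subgraph K G \<and> digraph_iso (with_proj F) K)"

definition isolating_set ::
  "'a pair_pre_digraph \<Rightarrow> 'c pair_pre_digraph set \<Rightarrow> 'a set \<Rightarrow> bool" where
  "isolating_set G \<F> S \<longleftrightarrow> S \<subseteq> pverts G \<and>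
     (\<forall>F\<in>\<F>. \<not> contains_copy (with_proj G \<restriction> (pverts G - closed_neighborhood G S)) F)"

text \<open>
  The infimum in \<^typ>\<open>enat\<close> is a minimum whenever an isolating set exists. One always exists
  (all of \<open>pverts G\<close>) unless \<open>\<F>\<close> has a member without vertices; in that case the value is \<open>\<infinity>\<close>.
\<close>

definition isolation_number ::
  "'a pair_pre_digraph \<Rightarrow> 'c pair_pre_digraph set \<Rightarrow> enat" where
  "isolation_number G \<F> = (INF S \<in> {S. isolating_set G \<F> S}. enat (card S))"

text \<open>Shortest-path cost for unit weights; it is \<open>\<infinity>\<close> between different components.\<close>

definition graph_dist :: "'a pair_pre_digraph \<Rightarrow> 'a \<Rightarrow> 'a \<Rightarrow> ereal" where
  "graph_dist G u v = wf_digraph.\<mu> (with_proj G) (\<lambda>_. 1) u v"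

definition two_packing :: "'a pair_pre_digraph \<Rightarrow> 'a set \<Rightarrow> bool" where
  "two_packing G P \<longleftrightarrow> P \<subseteq> pverts G \<and> (\<forall>u\<in>P. \<forall>v\<in>P. u \<noteq> v \<longrightarrow> graph_dist G u v \<ge> 3)"

definition packing_number :: "'a pair_pre_digraph \<Rightarrow> nat" where
  "packing_number G = Max {card P |P. two_packing G P}"

end

theory Submission
  imports Defs
begin

text \<open>
  Let \<open>S\<close> isolate \<open>\<F>\<close> in \<open>G \<boxtimes> H\<close> and let \<open>P\<close> be a \<open>2\<close>-packing of \<open>G\<close>. For \<open>g \<in> P\<close>, a vertex
  of the fibre \<open>{g} \<times> V(H)\<close> can be dominated only by vertices in the slab \<open>N[g] \<times> V(H)\<close>, and a
  vertex \<open>(x, y)\<close> of that slab dominates in the fibre exactly \<open>{g} \<times> N[y]\<close>. So the projection to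
  \<open>H\<close> of the part of \<open>S\<close> in the slab isolates \<open>\<F>\<close> in \<open>H\<close>: a copy that survives in \<open>H\<close> would
  survive in the fibre (\<open>isolating_set_projection\<close>). Hence each slab contains at least
  \<open>\<iota>(H, \<F>)\<close> elements of \<open>S\<close>. Closed neighbourhoods of vertices at distance at least three are
  disjoint (\<open>two_packing_disjoint\<close>), hence so are the slabs, and summing over \<open>P\<close> gives
  \<open>|P| \<iota>(H, \<F>) \<le> |S|\<close> (\<open>packing_bound\<close>). The other half of the bound follows from this one
  because \<open>G \<boxtimes> H\<close> and \<open>H \<boxtimes> G\<close> are isomorphic (\<open>isolation_number_commute\<close>).

  For sharpness, let \<open>G\<close> be the graph with a single vertex. Then \<open>G \<boxtimes> H\<close> is a copy of \<open>H\<close>, and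
  \<open>\<rho>\<^sub>2(G) = 1\<close>; so \<open>\<iota>(G \<boxtimes> H, \<F>) \<le> \<iota>(H, \<F>) = \<rho>\<^sub>2(G) \<iota>(H, \<F>)\<close>, and with the lower bound
  equality holds, for every \<open>\<F>\<close> and every \<open>H\<close> (\<open>single_vertex_sharp\<close>).
\<close>

section \<open>Strong products and closed neighbourhoods\<close>

lemma pverts_strong_product [simp]: "pverts (G \<boxtimes> H) = pverts G \<times> pverts H"
  by (simp add: strong_product_def)

lemma parcs_strong_product [simp]:
  "((g, h), (g', h')) \<in> parcs (G \<boxtimes> H) \<longleftrightarrow>
     g \<in> pverts G \<and> h \<in> pverts H \<and> g' \<in> pverts G \<and> h' \<in> pverts H \<and>
     (g, h) \<noteq> (g', h') \<and> (g = g' \<or> (g, g') \<in> parcs G) \<and> (h = h' \<or> (h, h') \<in> parcs H)"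
  by (simp add: strong_product_def)

lemma pair_wf_digraph_strong_product: "pair_wf_digraph (G \<boxtimes> H)"
  by unfold_locales (auto simp: strong_product_def)

lemma closed_neighborhood_iff:
  "v \<in> closed_neighborhood G S \<longleftrightarrow> v \<in> S \<or> (\<exists>u\<in>S. (u, v) \<in> parcs G)"
  by (auto simp: closed_neighborhood_def)

section \<open>Copies as embeddings\<close>

text \<open>
  An isomorphism of digraphs also carries a map on arcs and incidence functions for its image.
  Between graphs whose arcs are pairs these are determined by the map on vertices, so that a copy
  is the same thing as an injective homomorphism.
\<close>

lemma contains_copy_iff_embedding:
  assumes "pair_wf_digraph F" and "pair_wf_digraph G"
  shows "contains_copy (with_proj G \<restriction> U) F \<longleftrightarrow>
    (\<exists>f. inj_on f (pverts F) \<and> f ` pverts F \<subseteq> U \<and>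
         (\<forall>x y. (x, y) \<in> parcs F \<longrightarrow> (f x, f y) \<in> parcs G))"
    (is "?L \<longleftrightarrow> ?R")
proof
  assume ?L
  then obtain K i where sub: "subgraph K (with_proj G \<restriction> U)"
    and iso: "pre_digraph.digraph_isomorphism (with_proj F) i" and K: "K = app_iso i (with_proj F)"
    by (auto simp: contains_copy_def digraph_iso_def)
  have ends: "iso_tail i = fst" "iso_head i = snd"
    using sub by (auto simp: K subgraph_def compatible_def)
  have "(iso_verts i x, iso_verts i y) \<in> parcs G" if xy: "(x, y) \<in> parcs F" for x y
  proof -
    have "fst (iso_arcs i (x, y)) = iso_verts i x" "snd (iso_arcs i (x, y)) = iso_verts i y"
      using iso xy by (force simp: pre_digraph.digraph_isomorphism_def ends)+
    then have "iso_arcs i (x, y) = (iso_verts i x, iso_verts i y)"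
      by (metis prod.collapse)
    moreover have "iso_arcs i (x, y) \<in> parcs G"
      using sub xy by (auto simp: K subgraph_def)
    ultimately show ?thesis
      by simp
  qed
  moreover have "inj_on (iso_verts i) (pverts F)"
    using iso by (simp add: pre_digraph.digraph_isomorphism_def)
  moreover have "iso_verts i ` pverts F \<subseteq> U"
    using sub by (auto simp: K subgraph_def)
  ultimately show ?R
    by blast
next
  assume ?R
  then obtain f where inj: "inj_on f (pverts F)" and im: "f ` pverts F \<subseteq> U"
    and arc: "\<And>x y. (x, y) \<in> parcs F \<Longrightarrow> (f x, f y) \<in> parcs G"
    by blast
  interpret F: pair_wf_digraph F by fact
  interpret G: pair_wf_digraph G by fact
  define i where "i = \<lparr>iso_verts = f, iso_arcs = map_prod f f, iso_head = snd, iso_tail = fst\<rparr>"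
  have iso: "pre_digraph.digraph_isomorphism (with_proj F) i"
    unfolding pre_digraph.digraph_isomorphism_def
  proof (intro conjI)
    show "inj_on (iso_arcs i) (arcs (with_proj F))"
    proof (rule inj_on_subset)
      show "inj_on (iso_arcs i) (pverts F \<times> pverts F)"
        using map_prod_inj_on[OF inj inj] by (simp add: i_def)
    qed (auto dest: F.in_arcsD1 F.in_arcsD2)
  qed (use inj in \<open>auto simp: i_def F.wf_digraph_axioms\<close>)
  moreover have "subgraph (app_iso i (with_proj F)) (with_proj G \<restriction> U)"
    unfolding subgraph_def
  proof (intro conjI)
    show "wf_digraph (app_iso i (with_proj F))"
      using F.wf_digraphI_app_iso iso by blast
    show "arcs (app_iso i (with_proj F)) \<subseteq> arcs (with_proj G \<restriction> U)"
      using im arc by (auto simp: i_def image_subset_iff dest: F.in_arcsD1 F.in_arcsD2)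
  qed (use im in \<open>auto simp: i_def compatible_def G.wellformed_induce_subgraph\<close>)
  ultimately show ?L
    by (auto simp: contains_copy_def digraph_iso_def)
qed

section \<open>Isolating sets\<close>

lemma isolation_number_le: "isolating_set G \<F> S \<Longrightarrow> isolation_number G \<F> \<le> enat (card S)"
  unfolding isolation_number_def by (rule INF_lower) simp

lemma isolation_number_greatest:
  "(\<And>S. isolating_set G \<F> S \<Longrightarrow> n \<le> enat (card S)) \<Longrightarrow> n \<le> isolation_number G \<F>"
  unfolding isolation_number_def by (rule INF_greatest) simp

text \<open>
  A copy in the part of \<open>G\<close> left undominated by \<open>T\<close> composes with an embedding of that part into
  the undominated part of \<open>H\<close>. Every comparison of isolating sets below is an instance of this.
\<close>

lemma isolating_set_transfer:
  assumes F: "\<forall>F\<in>\<F>. pair_wf_digraph F" and G: "pair_wf_digraph G" and H: "pair_wf_digraph H"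
    and S: "isolating_set H \<F> S" and T: "T \<subseteq> pverts G"
    and inj: "inj_on f (pverts G - closed_neighborhood G T)"
    and im: "f ` (pverts G - closed_neighborhood G T) \<subseteq> pverts H - closed_neighborhood H S"
    and arc: "\<And>x y. (x, y) \<in> parcs G \<Longrightarrow> x \<notin> closed_neighborhood G T \<Longrightarrow>
      y \<notin> closed_neighborhood G T \<Longrightarrow> (f x, f y) \<in> parcs H"
  shows "isolating_set G \<F> T"
  unfolding isolating_set_def
proof (intro conjI ballI notI)
  fix F
  assume "F \<in> \<F>" and "contains_copy (with_proj G \<restriction> (pverts G - closed_neighborhood G T)) F"
  then obtain e where e: "inj_on e (pverts F)"
      "e ` pverts F \<subseteq> pverts G - closed_neighborhood G T"
      "\<And>x y. (x, y) \<in> parcs F \<Longrightarrow> (e x, e y) \<in> parcs G"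
    using F G by (auto simp: contains_copy_iff_embedding)
  interpret F: pair_wf_digraph F
    using F \<open>F \<in> \<F>\<close> by blast
  have "inj_on (f \<circ> e) (pverts F)"
    using e(1,2) inj by (blast intro: comp_inj_on inj_on_subset)
  moreover have "(f \<circ> e) ` pverts F \<subseteq> pverts H - closed_neighborhood H S"
    using e(2) im by (auto simp: image_subset_iff)
  moreover have "((f \<circ> e) x, (f \<circ> e) y) \<in> parcs H" if "(x, y) \<in> parcs F" for x y
  proof -
    have "x \<in> pverts F" "y \<in> pverts F"
      using that by (auto dest: F.in_arcsD1 F.in_arcsD2)
    then show ?thesis
      using arc[OF e(3)[OF that]] e(2) by auto
  qed
  ultimately have "contains_copy (with_proj H \<restriction> (pverts H - closed_neighborhood H S)) F"
    unfolding contains_copy_iff_embedding[OF F.pair_wf_digraph_axioms H] by blast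
  then show False
    using S \<open>F \<in> \<F>\<close> by (auto simp: isolating_set_def)
qed (fact T)

text \<open>
  The witnessing embedding is \<open>h \<mapsto> (g, h)\<close>. It maps arcs of \<open>H\<close> to arcs of the product because
  \<open>H\<close> has no loops.
\<close>

lemma isolating_set_projection:
  assumes F: "\<forall>F\<in>\<F>. pair_wf_digraph F" and G: "pair_sym_digraph G" and H: "pair_loopfree_digraph H"
    and S: "isolating_set (G \<boxtimes> H) \<F> S" and g: "g \<in> pverts G"
  shows "isolating_set H \<F> (snd ` (S \<inter> closed_neighborhood G {g} \<times> UNIV))"
    (is "isolating_set H \<F> ?T")
proof -
  interpret G: pair_sym_digraph G by fact
  interpret H: pair_loopfree_digraph H by fact
  have sub: "S \<subseteq> pverts G \<times> pverts H"
    using S by (simp add: isolating_set_def)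
  have undominated: "(g, h) \<notin> closed_neighborhood (G \<boxtimes> H) S" if h: "h \<notin> closed_neighborhood H ?T" for h
  proof
    assume "(g, h) \<in> closed_neighborhood (G \<boxtimes> H) S"
    then obtain x y where xy: "(x, y) \<in> S" "g = x \<or> (x, g) \<in> parcs G" "h = y \<or> (y, h) \<in> parcs H"
      by (auto simp: closed_neighborhood_iff)
    then have "x \<in> closed_neighborhood G {g}"
      by (auto simp: closed_neighborhood_iff intro: G.arcs_symmetric)
    then have "y \<in> ?T"
      using xy(1) by force
    then show False
      using h xy(3) by (auto simp: closed_neighborhood_iff)
  qed
  show ?thesis
  proof (rule isolating_set_transfer[OF F H.pair_wf_digraph_axioms pair_wf_digraph_strong_product S])
    show "?T \<subseteq> pverts H"
      using sub by auto
    show "inj_on (Pair g) (pverts H - closed_neighborhood H ?T)"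
      by (simp add: inj_on_def)
    show "Pair g ` (pverts H - closed_neighborhood H ?T)
        \<subseteq> pverts (G \<boxtimes> H) - closed_neighborhood (G \<boxtimes> H) S"
      using g undominated by auto
    show "((g, x), (g, y)) \<in> parcs (G \<boxtimes> H)" if "(x, y) \<in> parcs H" for x y
      using that g H.no_loops' by (auto dest: H.in_arcsD1 H.in_arcsD2)
  qed
qed

lemma isolation_number_commute_le:
  assumes F: "\<forall>F\<in>\<F>. pair_wf_digraph F"
  shows "isolation_number (H \<boxtimes> G) \<F> \<le> isolation_number (G \<boxtimes> H) \<F>"
proof (rule isolation_number_greatest)
  fix S
  assume S: "isolating_set (G \<boxtimes> H) \<F> S"
  have nbhd: "(y, x) \<in> closed_neighborhood (H \<boxtimes> G) (prod.swap ` S) \<longleftrightarrow>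
      (x, y) \<in> closed_neighborhood (G \<boxtimes> H) S" for x y
    by (fastforce simp: closed_neighborhood_iff)
  have "isolating_set (H \<boxtimes> G) \<F> (prod.swap ` S)"
  proof (rule isolating_set_transfer[OF F pair_wf_digraph_strong_product
        pair_wf_digraph_strong_product S, where f = prod.swap])
    show "prod.swap ` S \<subseteq> pverts (H \<boxtimes> G)"
      using S by (auto simp: isolating_set_def)
  qed (auto simp: nbhd)
  then show "isolation_number (H \<boxtimes> G) \<F> \<le> enat (card S)"
    by (metis isolation_number_le card_image inj_swap)
qed

lemma isolation_number_commute:
  assumes "\<forall>F\<in>\<F>. pair_wf_digraph F"
  shows "isolation_number (H \<boxtimes> G) \<F> = isolation_number (G \<boxtimes> H) \<F>"
  by (intro antisym isolation_number_commute_le assms)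

section \<open>2-packings\<close>

lemma graph_dist_le_length:
  assumes "pair_wf_digraph G" and "pre_digraph.awalk (with_proj G) u p v"
  shows "graph_dist G u v \<le> ereal (real (length p))"
proof -
  interpret pair_wf_digraph G by fact
  have "awalk_cost (\<lambda>_. 1) p = real (length p)"
    by (induction p) auto
  then show ?thesis
    using min_cost_le_walk_cost[OF assms(2), of "\<lambda>_. 1"] by (simp add: graph_dist_def)
qed

text \<open>A common vertex of two closed neighbourhoods yields a walk of length at most two.\<close>

lemma two_packing_disjoint:
  assumes G: "pair_sym_digraph G" and P: "two_packing G P"
    and uv: "u \<in> P" "v \<in> P" "u \<noteq> v"
  shows "closed_neighborhood G {u} \<inter> closed_neighborhood G {v} = {}"
proof (rule ccontr)
  interpret pair_sym_digraph G by fact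
  assume "closed_neighborhood G {u} \<inter> closed_neighborhood G {v} \<noteq> {}"
  then obtain x where "x = u \<or> (u, x) \<in> parcs G" "x = v \<or> (x, v) \<in> parcs G"
    unfolding closed_neighborhood_def using arcs_symmetric by blast
  moreover have "u \<in> pverts G" "v \<in> pverts G"
    using P uv by (auto simp: two_packing_def)
  ultimately have "awalk u [(u, v)] v \<or> awalk u [(u, x), (x, v)] v"
    using \<open>u \<noteq> v\<close> by (auto simp: awalk_simps dest: in_arcsD1 in_arcsD2)
  then obtain p where p: "awalk u p v" "length p \<le> 2"
    by force
  have "graph_dist G u v \<le> ereal (real (length p))"
    using graph_dist_le_length[OF pair_wf_digraph_axioms p(1)] .
  also have "\<dots> \<le> 2"
    using p(2) by simp
  finally have "graph_dist G u v < 3"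
    by (rule le_less_trans) simp
  then show False
    using P uv by (auto simp: two_packing_def not_le[symmetric])
qed

lemma finite_packing_cards:
  assumes "finite (pverts G)"
  shows "finite {card P |P. two_packing G P}"
proof -
  have "{card P |P. two_packing G P} \<subseteq> card ` Pow (pverts G)"
    by (auto simp: two_packing_def)
  then show ?thesis
    using assms finite_subset by blast
qed

lemma maximum_two_packing:
  assumes "finite (pverts G)"
  obtains P where "two_packing G P" "card P = packing_number G"
proof -
  have "two_packing G {}"
    by (simp add: two_packing_def)
  then have "packing_number G \<in> {card P |P. two_packing G P}"
    unfolding packing_number_def using finite_packing_cards[OF assms] by (intro Max_in) auto
  then show ?thesis
    using that by auto
qed

lemma packing_number_pos:
  assumes "finite (pverts G)" and "v \<in> pverts G"
  shows "packing_number G \<ge> 1"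
proof -
  have "two_packing G {v}"
    using assms(2) by (simp add: two_packing_def)
  then have "card {v} \<in> {card P |P. two_packing G P}"
    by blast
  then show ?thesis
    unfolding packing_number_def using finite_packing_cards[OF assms(1)] Max_ge by fastforce
qed

section \<open>The lower bound\<close>

lemma packing_bound:
  assumes F: "\<forall>F\<in>\<F>. pair_wf_digraph F" and G: "pair_graph G" and H: "pair_graph H"
  shows "enat (packing_number G) * isolation_number H \<F> \<le> isolation_number (G \<boxtimes> H) \<F>"
proof (rule isolation_number_greatest)
  interpret G: pair_graph G by fact
  interpret H: pair_graph H by fact
  fix S
  assume S: "isolating_set (G \<boxtimes> H) \<F> S"
  obtain P where P: "two_packing G P" and cardP: "card P = packing_number G"
    using maximum_two_packing G.pair_finite_verts by blast
  have P_sub: "P \<subseteq> pverts G"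
    using P by (simp add: two_packing_def)
  have "S \<subseteq> pverts G \<times> pverts H"
    using S by (simp add: isolating_set_def)
  then have finS: "finite S"
    using G.pair_finite_verts H.pair_finite_verts finite_subset by blast
  have finP: "finite P"
    using P_sub G.pair_finite_verts finite_subset by blast
  define slab where "slab g = S \<inter> closed_neighborhood G {g} \<times> UNIV" for g
  have slab_card: "isolation_number H \<F> \<le> enat (card (slab g))" if "g \<in> P" for g
  proof -
    have "isolating_set H \<F> (snd ` slab g)"
      unfolding slab_def using that P_sub
      by (intro isolating_set_projection[OF F G.pair_sym_digraph_axioms
            H.pair_loopfree_digraph_axioms S]) auto
    then have "isolation_number H \<F> \<le> enat (card (snd ` slab g))"
      by (rule isolation_number_le)
    also have "\<dots> \<le> enat (card (slab g))"
      using finS by (simp add: slab_def card_image_le)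
    finally show ?thesis .
  qed
  have "enat (packing_number G) * isolation_number H \<F> = (\<Sum>g\<in>P. isolation_number H \<F>)"
    by (simp add: cardP of_nat_eq_enat)
  also have "\<dots> \<le> (\<Sum>g\<in>P. enat (card (slab g)))"
    by (intro sum_mono slab_card)
  also have "\<dots> = enat (\<Sum>g\<in>P. card (slab g))"
    by (simp flip: of_nat_eq_enat)
  also have "(\<Sum>g\<in>P. card (slab g)) = card (\<Union>g\<in>P. slab g)"
  proof (rule card_UN_disjoint[symmetric, OF finP])
    show "\<forall>g\<in>P. finite (slab g)"
      using finS by (simp add: slab_def)
    show "\<forall>g\<in>P. \<forall>g'\<in>P. g \<noteq> g' \<longrightarrow> slab g \<inter> slab g' = {}"
      using two_packing_disjoint[OF G.pair_sym_digraph_axioms P] by (fastforce simp: slab_def)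
  qed
  also have "enat (card (\<Union>g\<in>P. slab g)) \<le> enat (card S)"
    using finS by (auto simp: slab_def intro: card_mono)
  finally show "enat (packing_number G) * isolation_number H \<F> \<le> enat (card S)" .
qed

lemma packing_bound_max:
  assumes "\<forall>F\<in>\<F>. pair_wf_digraph F" and "pair_graph G" and "pair_graph H"
  shows "max (enat (packing_number G) * isolation_number H \<F>)
             (enat (packing_number H) * isolation_number G \<F>) \<le> isolation_number (G \<boxtimes> H) \<F>"
  using packing_bound[OF assms] packing_bound[OF assms(1,3,2)]
  by (simp add: isolation_number_commute[OF assms(1), of H])

section \<open>Sharpness\<close>

text \<open>
  Over a single vertex \<open>v\<close>, the projection \<open>(v, h) \<mapsto> h\<close> embeds what \<open>{v} \<times> S\<close> leaves undominated
  into what \<open>S\<close> leaves undominated.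
\<close>

lemma isolation_number_single_vertex_product_le:
  assumes F: "\<forall>F\<in>\<F>. pair_wf_digraph F" and G: "pair_graph G" "pverts G = {v}"
    and H: "pair_graph H"
  shows "isolation_number (G \<boxtimes> H) \<F> \<le> isolation_number H \<F>"
proof (rule isolation_number_greatest)
  interpret G: pair_graph G by fact
  interpret H: pair_graph H by fact
  fix S
  assume S: "isolating_set H \<F> S"
  then have sub: "S \<subseteq> pverts H"
    by (simp add: isolating_set_def)
  have no_arcs: "(x, y) \<notin> parcs G" for x y
    using G.in_arcsD1[of x y] G.in_arcsD2[of x y] G.no_loops'[of x y] by (auto simp: G(2))
  have nbhd: "(v, h) \<in> closed_neighborhood (G \<boxtimes> H) (Pair v ` S)"
    if "h \<in> closed_neighborhood H S" for h
    using that sub by (auto simp: closed_neighborhood_iff G(2) dest: H.in_arcsD2 H.no_loops')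
  have "isolating_set (G \<boxtimes> H) \<F> (Pair v ` S)"
  proof (rule isolating_set_transfer[OF F pair_wf_digraph_strong_product
        H.pair_wf_digraph_axioms S, where f = snd])
    show "Pair v ` S \<subseteq> pverts (G \<boxtimes> H)"
      using sub by (auto simp: G(2))
  qed (auto simp: inj_on_def G(2) no_arcs dest: nbhd)
  then have "isolation_number (G \<boxtimes> H) \<F> \<le> enat (card (Pair v ` S))"
    by (rule isolation_number_le)
  also have "card (Pair v ` S) = card S"
    by (simp add: card_image inj_on_def)
  finally show "isolation_number (G \<boxtimes> H) \<F> \<le> enat (card S)" .
qed

lemma single_vertex_sharp:
  assumes F: "\<forall>F\<in>\<F>. pair_wf_digraph F" and G: "pair_graph G" "pverts G = {v}"
    and H: "pair_graph H"
  shows "isolation_number (G \<boxtimes> H) \<F> =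
    max (enat (packing_number G) * isolation_number H \<F>)
        (enat (packing_number H) * isolation_number G \<F>)"
proof (rule antisym)
  have "1 \<le> enat (packing_number G)"
    using packing_number_pos[of G v] by (simp add: G(2) one_enat_def)
  then have "1 * isolation_number H \<F> \<le> enat (packing_number G) * isolation_number H \<F>"
    by (rule mult_right_mono) simp
  then show "isolation_number (G \<boxtimes> H) \<F> \<le>
      max (enat (packing_number G) * isolation_number H \<F>)
          (enat (packing_number H) * isolation_number G \<F>)"
    using isolation_number_single_vertex_product_le[OF assms] by (auto simp: le_max_iff_disj)
qed (rule packing_bound_max[OF F G(1) H])

theorem theorem4p1:
  fixes \<F> :: "'c pair_pre_digraph set"
  assumes "\<forall>F\<in>\<F>. pair_graph F"
  shows "(\<forall>(G :: 'a pair_pre_digraph) (H :: 'b pair_pre_digraph).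
            pair_graph G \<longrightarrow> pair_graph H \<longrightarrow>
              isolation_number (G \<boxtimes> H) \<F> \<ge>
                max (enat (packing_number G) * isolation_number H \<F>)
                    (enat (packing_number H) * isolation_number G \<F>))
       \<and> (\<exists>(G :: nat pair_pre_digraph) (H :: nat pair_pre_digraph).
            pair_graph G \<and> pair_graph H \<and> pverts G \<noteq> {} \<and> pverts H \<noteq> {} \<and>
              isolation_number (G \<boxtimes> H) \<F> =
                max (enat (packing_number G) * isolation_number H \<F>)
                    (enat (packing_number H) * isolation_number G \<F>))"
proof -
  have F: "\<forall>F\<in>\<F>. pair_wf_digraph F"
    using assms by (auto simp: pair_graph_def pair_digraph.pair_wf_digraph)
  define K :: "nat pair_pre_digraph" where "K = \<lparr>pverts = {0}, parcs = {}\<rparr>"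
  have K: "pair_graph K"
    by unfold_locales (auto simp: K_def symmetric_def sym_def)
  have "isolation_number (K \<boxtimes> K) \<F> =
      max (enat (packing_number K) * isolation_number K \<F>)
          (enat (packing_number K) * isolation_number K \<F>)"
    by (rule single_vertex_sharp[OF F K _ K]) (simp add: K_def)
  moreover have "pverts K \<noteq> {}"
    by (simp add: K_def)
  ultimately show ?thesis
    using packing_bound_max[OF F] K by blast
qed

end
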